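(* The base family of genuine pairs is completely parametrized by \[ \rho_B(m)=\frac{6-2m}{m^2+7},\qquad u_B(m)=\frac{(m+1)(m-3)}{m^2+7}, \] where $m\in(-1,3)\cap\mathbb{Q}$ and $m\neq1$. That is, for every such $m$ these formulas give a genuine base pair (with $\rho=\rho_B(m)$ and $u=u_B(m)$), and every genuine base pair arises in this way from exactly one such $m$.
   Context: For $\rho\in\mathbb{Q}\cap(-1,1)$ and $q,u\in\mathbb{Q}$ consider triangles given by their triples of side lengths: \[ \tau(q)=\bigl(2(\rho-q),\,1-q^{2},\,q^{2}-2\rho q+1\bigr),\qquad \iota(u)=\bigl(2(1-\rho^{2}-u^{2}),\,u^{2}-\rho^{2}+1,\,u^{2}-\rho^{2}+1\bigr). \] The angle between the first two sides of $\tau(q)$ is the angle $\theta$ with $\cos\theta=\rho$. The triangle $\tau(q)$ is non-degenerate iff $|q|<1$ and $q<\rho$; $\iota(u)$ is an isosceles triangle, and is taken to be non-degenerate iff $-\sqrt{1-\rho^2}<u<0$. For $k\in\mathbb{Q}^\times$, $k\tau(q)$ is the rescaled triangle. The pair $(k\tau(q),\iota(u))$ is a genuine pair if both triangles are non-degenerate, they have equal perimeter and equal area, i.e. \[ k(1-q)=2(1-\rho),\qquad k^2(\rho-q)(1-q^2)=-2u(1-\rho^2-u^2), \] and they are not congruent. A genuine base pair is a genuine pair $(k\tau(q),\iota(u))$ with $0<\rho<1$ and $q=0$ (then necessarily $k=2(1-\rho)$); in this case $\tau(0)=(2\rho,1,1)$ is isosceles and $\theta$ is one of its two base angles. The base family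 is the set of all genuine base pairs, over all $\rho\in\mathbb{Q}\cap(0,1)$. *)

theory Defs
  imports Complex_Main "HOL-Library.Multiset"
begin

text \<open>A triangle is represented by the ordered triple of its (rational) side lengths.\<close>

type_synonym triangle = "rat \<times> rat \<times> rat"

definition scale :: "rat \<Rightarrow> triangle \<Rightarrow> triangle" where
  "scale k T = (case T of (a, b, c) \<Rightarrow> (k * a, k * b, k * c))"

definition nondegenerate :: "triangle \<Rightarrow> bool" where
  "nondegenerate T = (case T of (a, b, c) \<Rightarrow>
     0 < a \<and> 0 < b \<and> 0 < c \<and> a < b + c \<and> b < c + a \<and> c < a + b)"

definition perimeter :: "triangle \<Rightarrow> rat" where
  "perimeter T = (case T of (a, b, c) \<Rightarrow> a + b + c)"

text \<open>Heron's formula.\<close>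

definition area :: "triangle \<Rightarrow> real" where
  "area T = (case T of (a, b, c) \<Rightarrow>
     let s = (a + b + c) / 2 in sqrt (of_rat (s * (s - a) * (s - b) * (s - c))))"

text \<open>Congruence by the side-side-side criterion: the sides agree up to order.\<close>

definition congruent_triangles :: "triangle \<Rightarrow> triangle \<Rightarrow> bool" where
  "congruent_triangles S T = (case S of (a, b, c) \<Rightarrow> case T of (a', b', c') \<Rightarrow>
     {#a, b, c#} = {#a', b', c'#})"

definition tau :: "rat \<Rightarrow> rat \<Rightarrow> triangle" where
  "tau \<rho> q = (2 * (\<rho> - q), 1 - q\<^sup>2, q\<^sup>2 - 2 * \<rho> * q + 1)"

definition iota :: "rat \<Rightarrow> rat \<Rightarrow> triangle" where
  "iota \<rho> u = (2 * (1 - \<rho>\<^sup>2 - u\<^sup>2), u\<^sup>2 - \<rho>\<^sup>2 + 1, u\<^sup>2 - \<rho>\<^sup>2 + 1)"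

text \<open>Since \<open>iota \<rho> u = iota \<rho> (- u)\<close>, non-degeneracy of \<open>iota \<rho> u\<close> is by convention a
  condition on the parameter \<open>u\<close> that also fixes its sign; compare \<open>iota_nondegenerate\<close> below.\<close>

definition iota_nondeg :: "rat \<Rightarrow> rat \<Rightarrow> bool" where
  "iota_nondeg \<rho> u \<longleftrightarrow> - sqrt (1 - (of_rat \<rho>)\<^sup>2) < (of_rat u :: real) \<and> u < 0"

definition genuine_pair :: "rat \<Rightarrow> rat \<Rightarrow> rat \<Rightarrow> rat \<Rightarrow> bool" where
  "genuine_pair \<rho> k q u \<longleftrightarrow>
     -1 < \<rho> \<and> \<rho> < 1 \<and> k \<noteq> 0 \<and>
     nondegenerate (scale k (tau \<rho> q)) \<and> iota_nondeg \<rho> u \<and>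
     perimeter (scale k (tau \<rho> q)) = perimeter (iota \<rho> u) \<and>
     area (scale k (tau \<rho> q)) = area (iota \<rho> u) \<and>
     \<not> congruent_triangles (scale k (tau \<rho> q)) (iota \<rho> u)"

definition genuine_base_pair :: "rat \<Rightarrow> rat \<Rightarrow> rat \<Rightarrow> bool" where
  "genuine_base_pair \<rho> k u \<longleftrightarrow> 0 < \<rho> \<and> \<rho> < 1 \<and> genuine_pair \<rho> k 0 u"

definition base_family :: "(triangle \<times> triangle) set" where
  "base_family = {(scale k (tau \<rho> 0), iota \<rho> u) | \<rho> k u. genuine_base_pair \<rho> k u}"

definition rho_B :: "rat \<Rightarrow> rat" where
  "rho_B m = (6 - 2 * m) / (m\<^sup>2 + 7)"

definition u_B :: "rat \<Rightarrow> rat" where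
  "u_B m = ((m + 1) * (m - 3)) / (m\<^sup>2 + 7)"

text \<open>The following lemmas confirm the closed forms of the conditions in
  \<open>genuine_pair\<close>, and that \<open>\<rho>\<close> is the cosine of the angle between the first
  two sides of \<open>tau \<rho> q\<close> (law of cosines).\<close>

lemma tau_law_of_cosines:
  assumes "tau \<rho> q = (a, b, c)"
  shows "c\<^sup>2 = a\<^sup>2 + b\<^sup>2 - 2 * a * b * \<rho>"
proof -
  have "a = 2 * (\<rho> - q)" "b = 1 - q\<^sup>2" "c = q\<^sup>2 - 2 * \<rho> * q + 1"
    using assms by (simp_all add: tau_def)
  then show ?thesis by algebra
qed

lemma pos_quadratic:
  fixes \<rho> q :: rat
  assumes "-1 < \<rho>" "\<rho> < 1"
  shows "0 < q\<^sup>2 - 2 * \<rho> * q + 1"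
proof -
  have "\<rho>\<^sup>2 < 1" using assms by (simp add: abs_square_less_1)
  moreover have "q\<^sup>2 - 2 * \<rho> * q + 1 = (q - \<rho>)\<^sup>2 + (1 - \<rho>\<^sup>2)"
    by (simp add: power2_eq_square algebra_simps)
  ultimately show ?thesis using zero_le_power2[of "q - \<rho>"] by linarith
qed

lemma tau_nondegenerate_iff:
  assumes "-1 < \<rho>" "\<rho> < 1"
  shows "nondegenerate (scale k (tau \<rho> q)) \<longleftrightarrow> 0 < k \<and> \<bar>q\<bar> < 1 \<and> q < \<rho>"
proof
  assume *: "nondegenerate (scale k (tau \<rho> q))"
  then have k: "0 < k"
    using pos_quadratic[OF assms, of q]
    by (auto simp: nondegenerate_def scale_def tau_def zero_less_mult_iff)
  then show "0 < k \<and> \<bar>q\<bar> < 1 \<and> q < \<rho>"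
    using * by (auto simp: nondegenerate_def scale_def tau_def zero_less_mult_iff abs_square_less_1)
next
  assume *: "0 < k \<and> \<bar>q\<bar> < 1 \<and> q < \<rho>"
  then have q: "q\<^sup>2 < 1" "-1 < q" "q < 1" by (auto simp: abs_square_less_1)
  have 1: "0 < (1 + q) * (1 - \<rho>)" "0 < (1 - q) * (1 + \<rho>)" "0 < (1 + q) * (\<rho> - q)"
     "0 < (1 - q) * (\<rho> - q)"
    using q assms * by auto
  have 2: "2 * (\<rho> - q) < (1 - q\<^sup>2) + (q\<^sup>2 - 2 * \<rho> * q + 1)"
     "1 - q\<^sup>2 < (q\<^sup>2 - 2 * \<rho> * q + 1) + 2 * (\<rho> - q)"
     "q\<^sup>2 - 2 * \<rho> * q + 1 < 2 * (\<rho> - q) + (1 - q\<^sup>2)"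
    using 1 by (auto simp: algebra_simps power2_eq_square)
  show "nondegenerate (scale k (tau \<rho> q))"
    using 2 * q pos_quadratic[OF assms, of q]
    by (simp add: nondegenerate_def scale_def tau_def flip: distrib_left)
qed

lemma iota_nondeg_iff:
  assumes "-1 < \<rho>" "\<rho> < 1"
  shows "iota_nondeg \<rho> u \<longleftrightarrow> u < 0 \<and> u\<^sup>2 < 1 - \<rho>\<^sup>2"
proof (cases "u < 0")
  case True
  have "- sqrt (1 - (of_rat \<rho>)\<^sup>2) < (of_rat u :: real) \<longleftrightarrow>
        (of_rat (-u) :: real) < sqrt (of_rat (1 - \<rho>\<^sup>2))"
    by (auto simp: of_rat_diff of_rat_power of_rat_minus)
  also have "\<dots> \<longleftrightarrow> sqrt (of_rat ((-u)\<^sup>2)) < sqrt (of_rat (1 - \<rho>\<^sup>2))"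
    using True by (simp add: of_rat_power of_rat_minus)
  also have "\<dots> \<longleftrightarrow> u\<^sup>2 < 1 - \<rho>\<^sup>2" by (simp add: of_rat_less)
  finally show ?thesis using True by (simp add: iota_nondeg_def)
qed (simp add: iota_nondeg_def)

lemma iota_nondegenerate:
  assumes "-1 < \<rho>" "\<rho> < 1" "iota_nondeg \<rho> u"
  shows "nondegenerate (iota \<rho> u)"
proof -
  define v where "v = u\<^sup>2"
  have "0 < v" "v < 1 - \<rho>\<^sup>2"
    using assms by (auto simp: iota_nondeg_iff v_def)
  then have "0 < 1 - \<rho>\<^sup>2 - v" "0 < v - \<rho>\<^sup>2 + 1" "1 - \<rho>\<^sup>2 - v < v - \<rho>\<^sup>2 + 1"
    by linarith+
  then show ?thesis by (simp add: nondegenerate_def iota_def v_def)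
qed

lemma perimeter_eq_iff:
  assumes "-1 < \<rho>" "\<rho> < 1"
  shows "perimeter (scale k (tau \<rho> q)) = perimeter (iota \<rho> u) \<longleftrightarrow> k * (1 - q) = 2 * (1 - \<rho>)"
proof -
  have "perimeter (scale k (tau \<rho> q)) - perimeter (iota \<rho> u)
        = 2 * (1 + \<rho>) * (k * (1 - q) - 2 * (1 - \<rho>))"
    by (simp add: perimeter_def scale_def tau_def iota_def power2_eq_square algebra_simps)
  moreover have "2 * (1 + \<rho>) \<noteq> 0" using assms by simp
  ultimately show ?thesis by (metis eq_iff_diff_eq_0 mult_eq_0_iff)
qed

lemma sqrt_of_rat_square_mult:
  assumes "0 \<le> x"
  shows "sqrt (of_rat (x\<^sup>2 * y)) = of_rat x * sqrt (of_rat y)"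
  using assms by (simp add: of_rat_mult of_rat_power real_sqrt_mult)

lemma area_tau:
  assumes "-1 < \<rho>" "\<rho> < 1" "nondegenerate (scale k (tau \<rho> q))"
  shows "area (scale k (tau \<rho> q)) = of_rat (k\<^sup>2 * (\<rho> - q) * (1 - q\<^sup>2)) * sqrt (of_rat (1 - \<rho>\<^sup>2))"
proof -
  have "0 < k" "\<bar>q\<bar> < 1" "q < \<rho>" using assms tau_nondegenerate_iff by blast+
  then have nn: "0 \<le> k\<^sup>2 * (\<rho> - q) * (1 - q\<^sup>2)" by (simp add: abs_square_le_1)
  define a b c where "a = k * (2 * (\<rho> - q))" and "b = k * (1 - q\<^sup>2)"
    and "c = k * (q\<^sup>2 - 2 * \<rho> * q + 1)"
  define s where "s = (a + b + c) / 2"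
  have "s = k * (1 + \<rho>) * (1 - q)" "s - a = k * (1 - \<rho>) * (1 + q)"
    "s - b = k * (\<rho> - q) * (1 - q)" "s - c = k * (\<rho> - q) * (1 + q)"
    by (simp_all add: s_def a_def b_def c_def power2_eq_square field_simps)
  then have "s * (s - a) * (s - b) * (s - c)
      = (k * (1 + \<rho>) * (1 - q)) * (k * (1 - \<rho>) * (1 + q))
        * (k * (\<rho> - q) * (1 - q)) * (k * (\<rho> - q) * (1 + q))"
    by (simp only:)
  also have "\<dots> = (k\<^sup>2 * (\<rho> - q) * (1 - q\<^sup>2))\<^sup>2 * (1 - \<rho>\<^sup>2)"
    by algebra
  finally have "area (scale k (tau \<rho> q)) = sqrt (of_rat ((k\<^sup>2 * (\<rho> - q) * (1 - q\<^sup>2))\<^sup>2 * (1 - \<rho>\<^sup>2)))"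
    unfolding area_def scale_def tau_def Let_def prod.case s_def a_def b_def c_def by (simp only:)
  then show ?thesis by (simp only: sqrt_of_rat_square_mult[OF nn])
qed

lemma area_iota:
  assumes "-1 < \<rho>" "\<rho> < 1" "iota_nondeg \<rho> u"
  shows "area (iota \<rho> u) = of_rat (- 2 * u * (1 - \<rho>\<^sup>2 - u\<^sup>2)) * sqrt (of_rat (1 - \<rho>\<^sup>2))"
proof -
  have "u < 0" "u\<^sup>2 < 1 - \<rho>\<^sup>2" using assms by (auto simp: iota_nondeg_iff)
  then have nn: "0 \<le> - 2 * u * (1 - \<rho>\<^sup>2 - u\<^sup>2)"
    by (simp add: mult_le_0_iff)
  define a b where "a = 2 * (1 - \<rho>\<^sup>2 - u\<^sup>2)" and "b = u\<^sup>2 - \<rho>\<^sup>2 + 1"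
  define s where "s = (a + b + b) / 2"
  have "s = 2 * (1 - \<rho>\<^sup>2)" "s - a = 2 * u\<^sup>2" "s - b = 1 - \<rho>\<^sup>2 - u\<^sup>2"
    by (simp_all add: s_def a_def b_def field_simps)
  then have "s * (s - a) * (s - b) * (s - b)
      = 2 * (1 - \<rho>\<^sup>2) * (2 * u\<^sup>2) * (1 - \<rho>\<^sup>2 - u\<^sup>2) * (1 - \<rho>\<^sup>2 - u\<^sup>2)"
    by (simp only:)
  also have "\<dots> = (- 2 * u * (1 - \<rho>\<^sup>2 - u\<^sup>2))\<^sup>2 * (1 - \<rho>\<^sup>2)"
    by algebra
  finally have "area (iota \<rho> u) = sqrt (of_rat ((- 2 * u * (1 - \<rho>\<^sup>2 - u\<^sup>2))\<^sup>2 * (1 - \<rho>\<^sup>2)))"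
    unfolding area_def iota_def Let_def prod.case s_def a_def b_def by (simp only:)
  then show ?thesis by (simp only: sqrt_of_rat_square_mult[OF nn])
qed

lemma area_eq_iff:
  assumes "-1 < \<rho>" "\<rho> < 1" "nondegenerate (scale k (tau \<rho> q))" "iota_nondeg \<rho> u"
  shows "area (scale k (tau \<rho> q)) = area (iota \<rho> u) \<longleftrightarrow>
    k\<^sup>2 * (\<rho> - q) * (1 - q\<^sup>2) = - 2 * u * (1 - \<rho>\<^sup>2 - u\<^sup>2)"
proof -
  have "\<rho>\<^sup>2 < 1" using assms by (simp add: abs_square_less_1)
  then have nz: "sqrt (of_rat (1 - \<rho>\<^sup>2)) \<noteq> 0"
    by simp
  then show ?thesis
    unfolding area_tau[OF assms(1-3)] area_iota[OF assms(1,2,4)]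
    by (simp only: mult_right_cancel[OF nz] of_rat_eq_iff)
qed

end

theory Submission
  imports Defs
begin

text \<open>For \<open>q = 0\<close> the perimeter condition fixes \<open>k = 2 * (1 - \<rho>)\<close>, and the area condition becomes
  a cubic equation in \<open>(\<rho>, u)\<close>. The cubic is reducible, because every \<open>\<rho>\<close> admits the trivial
  solution \<open>u = - (1 - \<rho>)\<close>, in which the two triangles are congruent. Removing this line leaves
  the conic \<open>u\<^sup>2 = (1 - \<rho>) * (u + 2 * \<rho>)\<close>. Hence genuine base pairs are the rational points of the
  conic with \<open>0 < \<rho> < 1\<close> and \<open>u < 0\<close> that lie off the line
  (\<open>genuine_base_pair_iff_conic\<close>).

  The conic passes through the rational point \<open>(1, 0)\<close>, so it is parametrized by the slopes
  \<open>t = u / (1 - \<rho>)\<close> of the lines through that point: \<open>1 - \<rho> = 2 / (t\<^sup>2 - t + 2)\<close>. The substitution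
  \<open>t = (m - 3) / (m + 1)\<close> turns this into \<open>\<rho>\<^sub>B(m)\<close> and \<open>u\<^sub>B(m)\<close>, and takes \<open>-1 < m < 3\<close>
  bijectively to \<open>t < 0\<close>. The line of congruent pairs is the slope \<open>t = -1\<close>, that is \<open>m = 1\<close>.
  Solving for \<open>m\<close> gives the inverse \<open>m = (3 * (1 - \<rho>) + u) / ((1 - \<rho>) - u)\<close>.

  Finally the triangles determine the parameters: two sides of the first equal
  \<open>k = 2 * (1 - \<rho>)\<close>, and then the second determines \<open>u\<^sup>2\<close>, hence \<open>u\<close>, as \<open>u < 0\<close>. So
  the family is in bijection with \<open>m\<close> also when regarded as a set of pairs of triangles.\<close>

text \<open>An isosceles triangle is determined up to congruence by its base and its legs, because only the
  legs occur with multiplicity at least two.\<close>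

lemma congruent_isosceles_iff:
  "congruent_triangles (a, b, b) (a', b', b') \<longleftrightarrow> a = a' \<and> b = b'"
proof
  assume "congruent_triangles (a, b, b) (a', b', b')"
  then have eq: "{#a, b, b#} = {#a', b', b'#}"
    by (simp add: congruent_triangles_def)
  have "2 \<le> count {#a, b, b#} b" by simp
  then have "2 \<le> count {#a', b', b'#} b" by (simp only: eq)
  then have "b = b'" by (auto split: if_splits)
  then show "a = a' \<and> b = b'" using eq by simp
qed (simp add: congruent_triangles_def)

lemma scale_tau_0: "scale k (tau \<rho> 0) = (k * (2 * \<rho>), k, k)"
  by (simp add: scale_def tau_def)

text \<open>Comparing the legs alone leaves \<open>u\<^sup>2 = (1 - \<rho>)\<^sup>2\<close>, and the sign of \<open>u\<close> selects the root;
  for that root the bases agree as well.\<close>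

lemma congruent_base_pair_iff:
  assumes "\<rho> < 1" "u < 0"
  shows "congruent_triangles (scale (2 * (1 - \<rho>)) (tau \<rho> 0)) (iota \<rho> u) \<longleftrightarrow> u = \<rho> - 1"
proof
  assume "congruent_triangles (scale (2 * (1 - \<rho>)) (tau \<rho> 0)) (iota \<rho> u)"
  then have "2 * (1 - \<rho>) = u\<^sup>2 - \<rho>\<^sup>2 + 1"
    unfolding scale_tau_0 iota_def congruent_isosceles_iff by blast
  then have "u\<^sup>2 = (\<rho> - 1)\<^sup>2"
    by (simp add: power2_eq_square algebra_simps)
  then show "u = \<rho> - 1"
    using assms by (auto simp: power2_eq_iff)
next
  assume "u = \<rho> - 1"
  then show "congruent_triangles (scale (2 * (1 - \<rho>)) (tau \<rho> 0)) (iota \<rho> u)"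
    unfolding scale_tau_0 iota_def congruent_isosceles_iff by (intro conjI) algebra+
qed

text \<open>The area condition splits into the line of congruent pairs and a conic. On the conic the bound
  \<open>u\<^sup>2 < 1 - \<rho>\<^sup>2\<close> that makes \<open>iota \<rho> u\<close> non-degenerate comes for free, as
  \<open>u + 2 * \<rho> < 1 + \<rho>\<close>.\<close>

lemma genuine_base_pair_iff_conic:
  "genuine_base_pair \<rho> k u \<longleftrightarrow>
     0 < \<rho> \<and> \<rho> < 1 \<and> k = 2 * (1 - \<rho>) \<and> u < 0 \<and> u\<^sup>2 = (1 - \<rho>) * (u + 2 * \<rho>) \<and> u \<noteq> \<rho> - 1"
proof (cases "0 < \<rho> \<and> \<rho> < 1 \<and> k = 2 * (1 - \<rho>) \<and> u < 0")
  case True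
  then have \<rho>: "0 < \<rho>" "-1 < \<rho>" "\<rho> < 1" and k: "k = 2 * (1 - \<rho>)" and u: "u < 0" by auto
  have nondeg: "nondegenerate (scale k (tau \<rho> 0))"
    using \<rho> k by (simp add: tau_nondegenerate_iff)
  have perim: "perimeter (scale k (tau \<rho> 0)) = perimeter (iota \<rho> u)"
    using \<rho> k by (simp add: perimeter_eq_iff)
  have factorization: "k\<^sup>2 * \<rho> + 2 * u * (1 - \<rho>\<^sup>2 - u\<^sup>2)
      = 2 * (u - (\<rho> - 1)) * ((1 - \<rho>) * (u + 2 * \<rho>) - u\<^sup>2)"
    unfolding k by algebra
  have area: "k\<^sup>2 * \<rho> = - 2 * u * (1 - \<rho>\<^sup>2 - u\<^sup>2) \<longleftrightarrow>
      u = \<rho> - 1 \<or> u\<^sup>2 = (1 - \<rho>) * (u + 2 * \<rho>)"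
  proof -
    have "k\<^sup>2 * \<rho> = - 2 * u * (1 - \<rho>\<^sup>2 - u\<^sup>2) \<longleftrightarrow> k\<^sup>2 * \<rho> + 2 * u * (1 - \<rho>\<^sup>2 - u\<^sup>2) = 0"
      by (simp add: eq_neg_iff_add_eq_0)
    then show ?thesis unfolding factorization by auto
  qed
  have inside: "iota_nondeg \<rho> u" if "u\<^sup>2 = (1 - \<rho>) * (u + 2 * \<rho>)"
  proof -
    have "(1 - \<rho>) * (u + 2 * \<rho>) < (1 - \<rho>) * (1 + \<rho>)"
      using \<rho> u by (intro mult_strict_left_mono) auto
    also have "\<dots> = 1 - \<rho>\<^sup>2" by algebra
    finally show ?thesis using that u \<rho> by (simp add: iota_nondeg_iff)
  qed
  have "genuine_base_pair \<rho> k u \<longleftrightarrow> iota_nondeg \<rho> u \<and>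
      area (scale k (tau \<rho> 0)) = area (iota \<rho> u) \<and> u \<noteq> \<rho> - 1"
    using \<rho> u k nondeg perim congruent_base_pair_iff[of \<rho> u]
    by (simp add: genuine_base_pair_def genuine_pair_def)
  also have "\<dots> \<longleftrightarrow> u\<^sup>2 = (1 - \<rho>) * (u + 2 * \<rho>) \<and> u \<noteq> \<rho> - 1"
    using inside area area_eq_iff[OF \<rho>(2,3) nondeg] by auto
  finally show ?thesis using True by blast
next
  case False
  have "k = 2 * (1 - \<rho>) \<and> u < 0" if "genuine_base_pair \<rho> k u"
    using that perimeter_eq_iff[of \<rho> k 0 u]
    by (auto simp: genuine_base_pair_def genuine_pair_def iota_nondeg_def)
  with False show ?thesis by (auto simp: genuine_base_pair_def)
qed

lemma denominator_pos: "0 < (m :: rat)\<^sup>2 + 7"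
  by (simp add: add_nonneg_pos)

lemma one_minus_rho_B: "1 - rho_B m = (m + 1)\<^sup>2 / (m\<^sup>2 + 7)"
  using denominator_pos[of m] by (simp add: rho_B_def field_simps power2_eq_square)

text \<open>The pairs on the line \<open>u = \<rho> - 1\<close> of congruent triangles correspond to slope \<open>-1\<close>, which
  within the parameter range is \<open>m = 1\<close>.\<close>

lemma u_B_eq_rho_B_minus_1_iff:
  assumes "-1 < m"
  shows "u_B m = rho_B m - 1 \<longleftrightarrow> m = 1"
proof -
  have "u_B m - (rho_B m - 1) = u_B m + (1 - rho_B m)" by simp
  also have "\<dots> = 2 * (m + 1) * (m - 1) / (m\<^sup>2 + 7)"
    unfolding one_minus_rho_B u_B_def add_divide_distrib[symmetric]
    by (simp add: power2_eq_square algebra_simps)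
  finally have "u_B m - (rho_B m - 1) = 2 * (m + 1) * (m - 1) / (m\<^sup>2 + 7)" .
  then have "u_B m = rho_B m - 1 \<longleftrightarrow> 2 * (m + 1) * (m - 1) / (m\<^sup>2 + 7) = 0"
    by (metis eq_iff_diff_eq_0)
  then show ?thesis using assms denominator_pos[of m] by auto
qed

lemma rho_B_u_B_on_conic: "(u_B m)\<^sup>2 = (1 - rho_B m) * (u_B m + 2 * rho_B m)"
proof -
  define d where "d = m\<^sup>2 + 7"
  have "d \<noteq> 0" using denominator_pos[of m] by (simp add: d_def)
  then have "u_B m + 2 * rho_B m = (m - 3)\<^sup>2 / d"
    unfolding u_B_def rho_B_def d_def[symmetric] by (simp add: field_simps power2_eq_square)
  then show ?thesis
    unfolding one_minus_rho_B by (simp add: u_B_def d_def power2_eq_square)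
qed

lemma rho_B_u_B_bounds:
  assumes "-1 < m" "m < 3"
  shows "0 < rho_B m" "rho_B m < 1" "u_B m < 0"
proof -
  show "0 < rho_B m" using assms denominator_pos[of m] by (simp add: rho_B_def)
  have "0 < (m + 1)\<^sup>2 / (m\<^sup>2 + 7)" using assms denominator_pos[of m] by simp
  then show "rho_B m < 1" using one_minus_rho_B[of m] by linarith
  have "(m + 1) * (m - 3) < 0" using assms by (simp add: mult_pos_neg)
  then show "u_B m < 0" using denominator_pos[of m] by (simp add: u_B_def divide_neg_pos)
qed

lemma genuine_base_pair_rho_B_u_B:
  assumes "-1 < m" "m < 3" "m \<noteq> 1"
  shows "genuine_base_pair (rho_B m) (2 * (1 - rho_B m)) (u_B m)"
  using assms
  by (simp add: genuine_base_pair_iff_conic rho_B_u_B_bounds rho_B_u_B_on_conic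
        u_B_eq_rho_B_minus_1_iff)

text \<open>The slope \<open>t = u / (1 - \<rho>)\<close>, which is \<open>(m - 3) / (m + 1)\<close>, determines
  \<open>m = (3 + t) / (1 - t)\<close>.\<close>

lemma parameter_from_rho_B_u_B:
  assumes "-1 < m"
  shows "m = (3 * (1 - rho_B m) + u_B m) / ((1 - rho_B m) - u_B m)"
proof -
  define d where "d = m\<^sup>2 + 7"
  have d: "d \<noteq> 0" using denominator_pos[of m] by (simp add: d_def)
  have num: "3 * (1 - rho_B m) + u_B m = m * (4 * (m + 1)) / d"
    unfolding one_minus_rho_B u_B_def d_def[symmetric] using d
    by (simp add: field_simps power2_eq_square)
  have den: "(1 - rho_B m) - u_B m = 4 * (m + 1) / d"
    unfolding one_minus_rho_B u_B_def d_def[symmetric] using d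
    by (simp add: field_simps power2_eq_square)
  show ?thesis unfolding num den using d assms by simp
qed

lemma conic_point_parametrized:
  assumes "\<rho> < 1" "u < 0" and conic: "u\<^sup>2 = (1 - \<rho>) * (u + 2 * \<rho>)"
  obtains m where "-1 < m" "m < 3" "\<rho> = rho_B m" "u = u_B m"
proof -
  define s where "s = 1 - \<rho>"
  have s: "0 < s" "\<rho> = 1 - s" using assms by (auto simp: s_def)
  have conic_s: "u\<^sup>2 = s * (u + 2 * (1 - s))" using conic unfolding s(2) by simp
  define e where "e = s - u"
  have e: "0 < e" "u = s - e" using s \<open>u < 0\<close> by (auto simp: e_def)
  define m where "m = (3 * s + u) / e"
  have me: "m * e = 4 * s - e" unfolding m_def using e by simp
  \<comment> \<open>The conic equation expresses the common denominator of \<open>rho_B\<close> and \<open>u_B\<close> through \<open>s\<close>.\<close>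
  have den: "(m\<^sup>2 + 7) * e\<^sup>2 = 16 * s"
  proof -
    have "(m\<^sup>2 + 7) * e\<^sup>2 = (m * e)\<^sup>2 + 7 * e\<^sup>2" by algebra
    also have "\<dots> = (3 * s + u)\<^sup>2 + 7 * (s - u)\<^sup>2" unfolding me e(2) by algebra
    also have "\<dots> = 16 * s" using conic_s by algebra
    finally show ?thesis .
  qed
  have cancel: "x = y / (m\<^sup>2 + 7)" if "x * (16 * s) = y * e\<^sup>2" for x y
  proof -
    have "x * (m\<^sup>2 + 7) * e\<^sup>2 = y * e\<^sup>2" using that den by (simp add: mult.assoc)
    then have "x * (m\<^sup>2 + 7) = y" using e by simp
    then show ?thesis using denominator_pos[of m] by (simp add: eq_divide_eq)
  qed
  have "s = (m + 1)\<^sup>2 / (m\<^sup>2 + 7)"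
  proof (rule cancel)
    have "(m + 1)\<^sup>2 * e\<^sup>2 = (m * e + e)\<^sup>2" by algebra
    then show "s * (16 * s) = (m + 1)\<^sup>2 * e\<^sup>2" unfolding me by algebra
  qed
  then have "\<rho> = rho_B m" using one_minus_rho_B[of m] s(2) by linarith
  moreover have "u = u_B m" unfolding u_B_def
  proof (rule cancel)
    have "(m + 1) * (m - 3) * e\<^sup>2 = (m * e + e) * (m * e - 3 * e)" by algebra
    then show "u * (16 * s) = (m + 1) * (m - 3) * e\<^sup>2" unfolding me e(2) by algebra
  qed
  moreover have "-1 < m" unfolding m_def using e s by (simp add: less_divide_eq)
  moreover have "m < 3" unfolding m_def using e \<open>u < 0\<close> by (simp add: divide_less_eq)
  ultimately show thesis using that by blast
qed

lemma genuine_base_pair_parametrized: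
  assumes "genuine_base_pair \<rho> k u"
  shows "k = 2 * (1 - \<rho>)"
    and "\<exists>!m. -1 < m \<and> m < 3 \<and> m \<noteq> 1 \<and> \<rho> = rho_B m \<and> u = u_B m"
proof -
  have pair: "\<rho> < 1" "u < 0" "u\<^sup>2 = (1 - \<rho>) * (u + 2 * \<rho>)" "u \<noteq> \<rho> - 1"
    using assms by (auto simp: genuine_base_pair_iff_conic)
  show "k = 2 * (1 - \<rho>)" using assms by (simp add: genuine_base_pair_iff_conic)
  obtain m where m: "-1 < m" "m < 3" "\<rho> = rho_B m" "u = u_B m"
    using conic_point_parametrized[OF pair(1-3)] .
  show "\<exists>!m. -1 < m \<and> m < 3 \<and> m \<noteq> 1 \<and> \<rho> = rho_B m \<and> u = u_B m"
  proof (rule ex1I)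
    show "-1 < m \<and> m < 3 \<and> m \<noteq> 1 \<and> \<rho> = rho_B m \<and> u = u_B m"
      using m pair(4) u_B_eq_rho_B_minus_1_iff[of m] by auto
  next
    fix m'
    assume "-1 < m' \<and> m' < 3 \<and> m' \<noteq> 1 \<and> \<rho> = rho_B m' \<and> u = u_B m'"
    then show "m' = m"
      using m parameter_from_rho_B_u_B[of m] parameter_from_rho_B_u_B[of m'] by simp
  qed
qed

lemma base_pair_triangles_determine_parameters:
  assumes "scale (2 * (1 - \<rho>)) (tau \<rho> 0) = scale (2 * (1 - \<rho>')) (tau \<rho>' 0)"
    and "iota \<rho> u = iota \<rho>' u'" and "u < 0" "u' < 0"
  shows "\<rho> = \<rho>'" "u = u'"
proof -
  show \<rho>: "\<rho> = \<rho>'" using assms(1) by (simp add: scale_tau_0)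
  then have "u\<^sup>2 = u'\<^sup>2" using assms(2) by (simp add: iota_def)
  then show "u = u'" using assms(3,4) by (auto simp: power2_eq_iff)
qed

theorem theorem5p5:
  shows "(\<forall>m. -1 < m \<and> m < 3 \<and> m \<noteq> 1 \<longrightarrow>
            genuine_base_pair (rho_B m) (2 * (1 - rho_B m)) (u_B m))
       \<and> (\<forall>\<rho> k u. genuine_base_pair \<rho> k u \<longrightarrow>
            k = 2 * (1 - \<rho>) \<and>
            (\<exists>!m. -1 < m \<and> m < 3 \<and> m \<noteq> 1 \<and> \<rho> = rho_B m \<and> u = u_B m))
       \<and> bij_betw (\<lambda>m. (scale (2 * (1 - rho_B m)) (tau (rho_B m) 0), iota (rho_B m) (u_B m)))
            {m. -1 < m \<and> m < 3 \<and> m \<noteq> 1} base_family"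
proof (intro conjI allI impI)
  fix m :: rat
  assume "-1 < m \<and> m < 3 \<and> m \<noteq> 1"
  then show "genuine_base_pair (rho_B m) (2 * (1 - rho_B m)) (u_B m)"
    using genuine_base_pair_rho_B_u_B by blast
next
  fix \<rho> k u
  assume "genuine_base_pair \<rho> k u"
  then show "k = 2 * (1 - \<rho>)" "\<exists>!m. -1 < m \<and> m < 3 \<and> m \<noteq> 1 \<and> \<rho> = rho_B m \<and> u = u_B m"
    by (rule genuine_base_pair_parametrized)+
next
  let ?M = "{m :: rat. -1 < m \<and> m < 3 \<and> m \<noteq> 1}"
  let ?F = "\<lambda>m. (scale (2 * (1 - rho_B m)) (tau (rho_B m) 0), iota (rho_B m) (u_B m))"
  have "inj_on ?F ?M"
  proof (rule inj_onI)
    fix m m'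
    assume "m \<in> ?M" "m' \<in> ?M" and eq: "?F m = ?F m'"
    then have m: "-1 < m" "m < 3" "-1 < m'" "m' < 3" by auto
    have "rho_B m = rho_B m'" "u_B m = u_B m'"
      using eq m
      by (auto intro: base_pair_triangles_determine_parameters[of "rho_B m" "rho_B m'"]
            rho_B_u_B_bounds)
    then show "m = m'"
      using m parameter_from_rho_B_u_B[of m] parameter_from_rho_B_u_B[of m'] by simp
  qed
  moreover have "?F ` ?M = base_family"
  proof (intro equalityI subsetI)
    fix p
    assume "p \<in> ?F ` ?M"
    then show "p \<in> base_family"
      unfolding base_family_def using genuine_base_pair_rho_B_u_B by blast
  next
    fix p
    assume "p \<in> base_family"
    then obtain \<rho> k u where p: "p = (scale k (tau \<rho> 0), iota \<rho> u)" "genuine_base_pair \<rho> k u"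
      unfolding base_family_def by blast
    then obtain m where "m \<in> ?M" "\<rho> = rho_B m" "u = u_B m" "k = 2 * (1 - \<rho>)"
      using genuine_base_pair_parametrized[OF p(2)] by blast
    then show "p \<in> ?F ` ?M" using p(1) by blast
  qed
  ultimately show "bij_betw ?F ?M base_family" by (simp add: bij_betw_def)
qed

end
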